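(* Let $I_1 > I_3 > 0$ be real numbers. Consider the Euler equations of the symmetric free rigid body on $\mathbb{R}^3$, $$\dot m_1 = a_1 m_2 m_3,\qquad \dot m_2 = -a_1 m_1 m_3,\qquad \dot m_3 = 0,\qquad a_1=\frac{1}{I_3}-\frac{1}{I_1},$$ with their Hamilton–Poisson realization $(\mathbb{R}^3,\Pi,H)$, where for $m=(m_1,m_2,m_3)$ $$\Pi(m)=\begin{bmatrix}0&-m_3&m_2\\ m_3&0&-m_1\\ -m_2&m_1&0\end{bmatrix},\qquad H(m)=\frac12\left(\frac{m_1^2}{I_1}+\frac{m_2^2}{I_1}+\frac{m_3^2}{I_3}\right).$$ Split $H=H_1+H_2+H_3$ with $H_1(m)=\frac{1}{2I_1}m_1^2$, $H_2(m)=\frac{1}{2I_1}m_2^2$, $H_3(m)=\frac{1}{2I_3}m_3^2$, and let $$\phi_t=\exp(tX_{H_1})\circ\exp(tX_{H_2})\circ\exp(tX_{H_3}):\mathbb{R}^3\to\mathbb{R}^3,\qquad t\in\mathbb{R},$$ be the associated Lie–Trotter integrator. Then $\{\phi_t\}_{t\in\mathbb{R}}$ is a Poisson integrator on $(\mathbb{R}^3,\Pi)$.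
   Context: A matrix-valued function $\Pi=[\{x_i,x_j\}]$ on $\mathbb{R}^n$ denotes the Poisson structure $\{f,g\}=(\nabla f)^{T}\,\Pi\,\nabla g$ for $f,g\in C^\infty(\mathbb{R}^n,\mathbb{R})$; the Hamiltonian vector field of $F\in C^\infty(\mathbb{R}^n,\mathbb{R})$ is $X_F=\Pi\,\nabla F$, and $\exp(tX_F)$ denotes its time-$t$ flow. A numerical integrator on $\mathbb{R}^n$ is a family of $C^\infty$ maps $\phi_t:\mathbb{R}^n\to\mathbb{R}^n$, $t\in\mathbb{R}$, depending differentiably on $t$ (one writes $x_{n+1}=\phi_t(x_n)$). It is a Poisson integrator if $\{f,g\}\circ\phi_t=\{f\circ\phi_t,\,g\circ\phi_t\}$ for all $f,g\in C^\infty(\mathbb{R}^n,\mathbb{R})$ and all $t\in\mathbb{R}$; equivalently, $D\phi_t(x)\,\Pi(x)\,D\phi_t(x)^{T}=\Pi(\phi_t(x))$ for all $t\in\mathbb{R}$, $x\in\mathbb{R}^n$. For a Hamiltonian written as a finite sum whose summands have explicitly integrable Hamiltonian flows, the Lie–Trotter integrator is the composition of the time-$t$ flows of the summands. Here the three flows are, with $m(0)$ the initial point of the respective flow: $\exp(tX_{H_1})$: $m_1(t)=m_1(0)$, $m_2(t)=\cos(\alpha t)m_2(0)+\sin(\alpha t)m_3(0)$, $m_3(t)=-\sin(\alpha t)m_2(0)+\cos(\alpha t)m_3(0)$, with $\alpha=m_1(0)/I_1$; $\exp(tX_{H_2})$: $m_1(t)=\cos(\beta t)m_1(0)-\sin(\beta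 t)m_3(0)$, $m_2(t)=m_2(0)$, $m_3(t)=\sin(\beta t)m_1(0)+\cos(\beta t)m_3(0)$, with $\beta=m_2(0)/I_1$; $\exp(tX_{H_3})$: $m_1(t)=\cos(\gamma t)m_1(0)+\sin(\gamma t)m_2(0)$, $m_2(t)=-\sin(\gamma t)m_1(0)+\cos(\gamma t)m_2(0)$, $m_3(t)=m_3(0)$, with $\gamma=m_3(0)/I_3$. *)

theory Defs
  imports "HOL-Analysis.Analysis"
begin

(* f is k times continuously differentiable on the whole space: all iterated directional
   derivatives of f up to order k exist as Frechet derivatives and are continuous. *)
primrec times_cont_differentiable ::
  "nat \<Rightarrow> ('a::real_normed_vector \<Rightarrow> 'b::real_normed_vector) \<Rightarrow> bool" where
  "times_cont_differentiable 0 f \<longleftrightarrow> continuous_on UNIV f"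
| "times_cont_differentiable (Suc k) f \<longleftrightarrow>
     (\<forall>x. f differentiable (at x)) \<and>
     (\<forall>v. times_cont_differentiable k (\<lambda>x. frechet_derivative f (at x) v))"

definition smooth :: "('a::euclidean_space \<Rightarrow> 'b::euclidean_space) \<Rightarrow> bool" where
  "smooth f \<longleftrightarrow> (\<forall>k. times_cont_differentiable k f)"

definition gradient :: "(real^'n \<Rightarrow> real) \<Rightarrow> real^'n \<Rightarrow> real^'n" where
  "gradient F x = (THE D. GDERIV F x :> D)"

definition poisson_bracket ::
  "(real^'n \<Rightarrow> real^'n^'n) \<Rightarrow> (real^'n \<Rightarrow> real) \<Rightarrow> (real^'n \<Rightarrow> real) \<Rightarrow> real^'n \<Rightarrow> real" where
  "poisson_bracket P f g = (\<lambda>x. gradient f x \<bullet> (P x *v gradient g x))"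

definition hamiltonian_vf ::
  "(real^'n \<Rightarrow> real^'n^'n) \<Rightarrow> (real^'n \<Rightarrow> real) \<Rightarrow> real^'n \<Rightarrow> real^'n" where
  "hamiltonian_vf P F = (\<lambda>x. P x *v gradient F x)"

(* c is an integral curve of X defined for all time. *)
definition integral_curve :: "('a::real_normed_vector \<Rightarrow> 'a) \<Rightarrow> (real \<Rightarrow> 'a) \<Rightarrow> bool" where
  "integral_curve X c \<longleftrightarrow> (\<forall>s. (c has_vector_derivative X (c s)) (at s))"

(* The time-t flow exp(tX). The description denotes the flow only when exactly one integral
   curve defined for all time starts at each x (complete vector fields with unique solutions);
   for the three vector fields used below this is lemmas flow_H1, flow_H2, flow_H3. *)
definition flow :: "('a::real_normed_vector \<Rightarrow> 'a) \<Rightarrow> real \<Rightarrow> 'a \<Rightarrow> 'a" where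
  "flow X t x = (THE c. integral_curve X c \<and> c 0 = x) t"

(* No group property in t and no condition at t = 0 is required of an integrator.
   Dependence on t is required to be differentiable at each fixed point x. *)
definition numerical_integrator :: "(real \<Rightarrow> real^'n \<Rightarrow> real^'n) \<Rightarrow> bool" where
  "numerical_integrator \<phi> \<longleftrightarrow>
     (\<forall>t. smooth (\<phi> t)) \<and> (\<forall>x t. (\<lambda>s. \<phi> s x) differentiable (at t))"

definition poisson_integrator ::
  "(real^'n \<Rightarrow> real^'n^'n) \<Rightarrow> (real \<Rightarrow> real^'n \<Rightarrow> real^'n) \<Rightarrow> bool" where
  "poisson_integrator P \<phi> \<longleftrightarrow> numerical_integrator \<phi> \<and>
     (\<forall>f g t. smooth f \<longrightarrow> smooth g \<longrightarrow>
        poisson_bracket P f g \<circ> \<phi> t = poisson_bracket P (f \<circ> \<phi> t) (g \<circ> \<phi> t))"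

definition rigid_body_Pi :: "real^3 \<Rightarrow> real^3^3" where
  "rigid_body_Pi m = vector [vector [0, - m$3, m$2],
                             vector [m$3, 0, - m$1],
                             vector [- m$2, m$1, 0]]"

definition rigid_body_H :: "real \<Rightarrow> real \<Rightarrow> real^3 \<Rightarrow> real" where
  "rigid_body_H I1 I3 m = 1/2 * ((m$1)\<^sup>2 / I1 + (m$2)\<^sup>2 / I1 + (m$3)\<^sup>2 / I3)"

definition H1 :: "real \<Rightarrow> real^3 \<Rightarrow> real" where "H1 I1 m = 1 / (2 * I1) * (m$1)\<^sup>2"
definition H2 :: "real \<Rightarrow> real^3 \<Rightarrow> real" where "H2 I1 m = 1 / (2 * I1) * (m$2)\<^sup>2"
definition H3 :: "real \<Rightarrow> real^3 \<Rightarrow> real" where "H3 I3 m = 1 / (2 * I3) * (m$3)\<^sup>2"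

definition euler_vf :: "real \<Rightarrow> real \<Rightarrow> real^3 \<Rightarrow> real^3" where
  "euler_vf I1 I3 m = (let a1 = 1 / I3 - 1 / I1 in vector [a1 * m$2 * m$3, - a1 * m$1 * m$3, 0])"

definition lie_trotter :: "real \<Rightarrow> real \<Rightarrow> real \<Rightarrow> real^3 \<Rightarrow> real^3" where
  "lie_trotter I1 I3 t =
     flow (hamiltonian_vf rigid_body_Pi (H1 I1)) t \<circ>
     flow (hamiltonian_vf rigid_body_Pi (H2 I1)) t \<circ>
     flow (hamiltonian_vf rigid_body_Pi (H3 I3)) t"

lemma rigid_body_H_split: "rigid_body_H I1 I3 m = H1 I1 m + H2 I1 m + H3 I3 m"
  by (simp add: rigid_body_H_def H1_def H2_def H3_def add_divide_distrib)

lemma gradient_eqI: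
  assumes "GDERIV F x :> D" shows "gradient F x = D"
  unfolding gradient_def
proof (rule the_equality, rule assms)
  fix E assume "GDERIV F x :> E"
  then have "(\<lambda>h. h \<bullet> E) = (\<lambda>h. h \<bullet> D)"
    using assms unfolding gderiv_def by (rule has_derivative_unique)
  then show "E = D" by (metis inner_commute vector_eq_rdot)
qed

lemma gradient_quadratic:
  "gradient (\<lambda>m::real^3. a * (m$1)\<^sup>2 + b * (m$2)\<^sup>2 + c * (m$3)\<^sup>2) x =
     vector [2 * a * x$1, 2 * b * x$2, 2 * c * x$3]"
proof (rule gradient_eqI)
  have nth: "((\<lambda>m. m $ i) has_derivative (\<lambda>h. h $ i)) (at x)" for i
    by (rule bounded_linear_imp_has_derivative[OF bounded_linear_vec_nth])
  show "GDERIV (\<lambda>m. a * (m$1)\<^sup>2 + b * (m$2)\<^sup>2 + c * (m$3)\<^sup>2) x :>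
      vector [2 * a * x$1, 2 * b * x$2, 2 * c * x$3]"
    unfolding gderiv_def
    by (auto intro!: derivative_eq_intros nth simp: inner_vec_def sum_3 algebra_simps)
qed

lemma rigid_body_vf:
  "hamiltonian_vf rigid_body_Pi (\<lambda>m. a * (m$1)\<^sup>2 + b * (m$2)\<^sup>2 + c * (m$3)\<^sup>2) x =
     vector [2 * (c - b) * x$2 * x$3, 2 * (a - c) * x$1 * x$3, 2 * (b - a) * x$1 * x$2]"
  unfolding hamiltonian_vf_def gradient_quadratic
  by (simp add: rigid_body_Pi_def vec_eq_iff forall_3 matrix_vector_mult_def sum_3 algebra_simps)

lemma hamiltonian_vf_rigid_body:
  "hamiltonian_vf rigid_body_Pi (rigid_body_H I1 I3) = euler_vf I1 I3"
proof
  fix x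
  have "rigid_body_H I1 I3 =
      (\<lambda>m. 1 / (2*I1) * (m$1)\<^sup>2 + 1 / (2*I1) * (m$2)\<^sup>2 + 1 / (2*I3) * (m$3)\<^sup>2)"
    by (auto simp: rigid_body_H_def add_divide_distrib)
  then show "hamiltonian_vf rigid_body_Pi (rigid_body_H I1 I3) x = euler_vf I1 I3 x"
    by (simp only: rigid_body_vf) (simp add: euler_vf_def vec_eq_iff forall_3 algebra_simps)
qed

lemma hamiltonian_vf_H1:
  "hamiltonian_vf rigid_body_Pi (H1 I1) x = vector [0, x$1 / I1 * x$3, - (x$1 / I1 * x$2)]"
  using rigid_body_vf[of "1/(2*I1)" 0 0 x]
  by (simp add: H1_def[abs_def] vec_eq_iff forall_3)

lemma hamiltonian_vf_H2:
  "hamiltonian_vf rigid_body_Pi (H2 I1) x = vector [- (x$2 / I1 * x$3), 0, x$2 / I1 * x$1]"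
  using rigid_body_vf[of 0 "1/(2*I1)" 0 x]
  by (simp add: H2_def[abs_def] vec_eq_iff forall_3)

lemma hamiltonian_vf_H3:
  "hamiltonian_vf rigid_body_Pi (H3 I3) x = vector [x$3 / I3 * x$2, - (x$3 / I3 * x$1), 0]"
  using rigid_body_vf[of 0 0 "1/(2*I3)" x]
  by (simp add: H3_def[abs_def] vec_eq_iff forall_3)

lemma flow_eqI:
  assumes "integral_curve X c" "c 0 = x"
    and "\<And>d. integral_curve X d \<Longrightarrow> d 0 = x \<Longrightarrow> d = c"
  shows "flow X t x = c t"
proof -
  have "(THE c. integral_curve X c \<and> c 0 = x) = c"
    by (rule the_equality) (use assms in blast)+
  then show ?thesis by (simp add: flow_def)
qed

lemma has_vector_derivative_vec3:
  fixes c :: "real \<Rightarrow> real^3"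
  shows "(c has_vector_derivative v) (at s) \<longleftrightarrow>
    ((\<lambda>s. c s $ 1) has_real_derivative v$1) (at s) \<and>
    ((\<lambda>s. c s $ 2) has_real_derivative v$2) (at s) \<and>
    ((\<lambda>s. c s $ 3) has_real_derivative v$3) (at s)"
proof -
  have "(c has_vector_derivative v) (at s) \<longleftrightarrow>
      (\<forall>i. ((\<lambda>s. c s $ i) has_real_derivative v$i) (at s))"
    unfolding has_vector_derivative_def has_field_derivative_def
    by (subst has_derivative_componentwise_within)
       (auto simp: Basis_vec_def inner_axis mult.commute[of _ "v $ _"] fun_eq_iff)
  then show ?thesis by (simp add: forall_3)
qed

lemma rotation_unique:
  fixes p q :: "real \<Rightarrow> real"
  assumes p: "\<And>s. (p has_real_derivative w * q s) (at s)"
    and q: "\<And>s. (q has_real_derivative - (w * p s)) (at s)"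
  shows "p s = cos (w * s) * p 0 + sin (w * s) * q 0"
    and "q s = - sin (w * s) * p 0 + cos (w * s) * q 0"
proof -
  define u where "u s = cos (w * s) * p s - sin (w * s) * q s" for s
  define v where "v s = sin (w * s) * p s + cos (w * s) * q s" for s
  have "(u has_real_derivative 0) (at s)" for s
    unfolding u_def by (auto intro!: derivative_eq_intros p q simp: algebra_simps)
  then have u: "u s = u 0" by (metis DERIV_isconst_all)
  have "(v has_real_derivative 0) (at s)" for s
    unfolding v_def by (auto intro!: derivative_eq_intros p q simp: algebra_simps)
  then have v: "v s = v 0" by (metis DERIV_isconst_all)
  have "p s = ((cos (w * s))\<^sup>2 + (sin (w * s))\<^sup>2) * p s" by simp
  also have "\<dots> = cos (w * s) * u s + sin (w * s) * v s"
    unfolding u_def v_def by algebra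
  finally show "p s = cos (w * s) * p 0 + sin (w * s) * q 0"
    using u v by (simp add: u_def v_def)
  have "q s = ((cos (w * s))\<^sup>2 + (sin (w * s))\<^sup>2) * q s" by simp
  also have "\<dots> = - sin (w * s) * u s + cos (w * s) * v s"
    unfolding u_def v_def by algebra
  finally show "q s = - sin (w * s) * p 0 + cos (w * s) * q 0"
    using u v by (simp add: u_def v_def)
qed

lemma flow_H1:
  "flow (hamiltonian_vf rigid_body_Pi (H1 I1)) t m =
     (let \<alpha> = m$1 / I1 in
      vector [m$1,
              cos (\<alpha> * t) * m$2 + sin (\<alpha> * t) * m$3,
              - sin (\<alpha> * t) * m$2 + cos (\<alpha> * t) * m$3])"
proof -
  define w where "w = m$1 / I1"
  define c :: "real \<Rightarrow> real^3" where
    "c = (\<lambda>t. vector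
             [m$1,
              cos (w * t) * m$2 + sin (w * t) * m$3,
              - sin (w * t) * m$2 + cos (w * t) * m$3])"
  have "flow (hamiltonian_vf rigid_body_Pi (H1 I1)) t m = c t"
  proof (rule flow_eqI)
    show "integral_curve (hamiltonian_vf rigid_body_Pi (H1 I1)) c"
      unfolding integral_curve_def has_vector_derivative_vec3 hamiltonian_vf_H1
      by (auto simp: c_def algebra_simps simp flip: w_def intro!: derivative_eq_intros)
    show "c 0 = m" by (simp add: c_def vec_eq_iff forall_3)
  next
    fix d assume d: "integral_curve (hamiltonian_vf rigid_body_Pi (H1 I1)) d" and d0: "d 0 = m"
    note D = d[unfolded integral_curve_def has_vector_derivative_vec3 hamiltonian_vf_H1]
    have const: "d s $ 1 = m $ 1" for s
      using D DERIV_isconst_all[of "\<lambda>s. d s $ 1" s 0] d0 by simp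
    have "d s $ 2 = cos (w * s) * m$2 + sin (w * s) * m$3"
      "d s $ 3 = - sin (w * s) * m$2 + cos (w * s) * m$3" for s
      using rotation_unique[of "\<lambda>s. d s $ 2" w "\<lambda>s. d s $ 3" s] D d0
      by (simp_all add: const w_def)
    then show "d = c" by (simp add: c_def fun_eq_iff vec_eq_iff forall_3 const)
  qed
  then show ?thesis by (simp add: c_def w_def)
qed

lemma flow_H2:
  "flow (hamiltonian_vf rigid_body_Pi (H2 I1)) t m =
     (let \<beta> = m$2 / I1 in
      vector [cos (\<beta> * t) * m$1 - sin (\<beta> * t) * m$3,
              m$2,
              sin (\<beta> * t) * m$1 + cos (\<beta> * t) * m$3])"
proof -
  define w where "w = m$2 / I1"
  define c :: "real \<Rightarrow> real^3" where
    "c = (\<lambda>t. vector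
             [cos (w * t) * m$1 - sin (w * t) * m$3,
              m$2,
              sin (w * t) * m$1 + cos (w * t) * m$3])"
  have "flow (hamiltonian_vf rigid_body_Pi (H2 I1)) t m = c t"
  proof (rule flow_eqI)
    show "integral_curve (hamiltonian_vf rigid_body_Pi (H2 I1)) c"
      unfolding integral_curve_def has_vector_derivative_vec3 hamiltonian_vf_H2
      by (auto simp: c_def algebra_simps simp flip: w_def intro!: derivative_eq_intros)
    show "c 0 = m" by (simp add: c_def vec_eq_iff forall_3)
  next
    fix d assume d: "integral_curve (hamiltonian_vf rigid_body_Pi (H2 I1)) d" and d0: "d 0 = m"
    note D = d[unfolded integral_curve_def has_vector_derivative_vec3 hamiltonian_vf_H2]
    have const: "d s $ 2 = m $ 2" for s
      using D DERIV_isconst_all[of "\<lambda>s. d s $ 2" s 0] d0 by simp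
    have "d s $ 3 = cos (w * s) * m$3 + sin (w * s) * m$1"
      "d s $ 1 = - sin (w * s) * m$3 + cos (w * s) * m$1" for s
      using rotation_unique[of "\<lambda>s. d s $ 3" w "\<lambda>s. d s $ 1" s] D d0
      by (simp_all add: const w_def)
    then show "d = c" by (simp add: c_def fun_eq_iff vec_eq_iff forall_3 const)
  qed
  then show ?thesis by (simp add: c_def w_def)
qed

lemma flow_H3:
  "flow (hamiltonian_vf rigid_body_Pi (H3 I3)) t m =
     (let \<gamma> = m$3 / I3 in
      vector [cos (\<gamma> * t) * m$1 + sin (\<gamma> * t) * m$2,
              - sin (\<gamma> * t) * m$1 + cos (\<gamma> * t) * m$2,
              m$3])"
proof -
  define w where "w = m$3 / I3"
  define c :: "real \<Rightarrow> real^3" where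
    "c = (\<lambda>t. vector
             [cos (w * t) * m$1 + sin (w * t) * m$2,
              - sin (w * t) * m$1 + cos (w * t) * m$2,
              m$3])"
  have "flow (hamiltonian_vf rigid_body_Pi (H3 I3)) t m = c t"
  proof (rule flow_eqI)
    show "integral_curve (hamiltonian_vf rigid_body_Pi (H3 I3)) c"
      unfolding integral_curve_def has_vector_derivative_vec3 hamiltonian_vf_H3
      by (auto simp: c_def algebra_simps simp flip: w_def intro!: derivative_eq_intros)
    show "c 0 = m" by (simp add: c_def vec_eq_iff forall_3)
  next
    fix d assume d: "integral_curve (hamiltonian_vf rigid_body_Pi (H3 I3)) d" and d0: "d 0 = m"
    note D = d[unfolded integral_curve_def has_vector_derivative_vec3 hamiltonian_vf_H3]
    have const: "d s $ 3 = m $ 3" for s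
      using D DERIV_isconst_all[of "\<lambda>s. d s $ 3" s 0] d0 by simp
    have "d s $ 1 = cos (w * s) * m$1 + sin (w * s) * m$2"
      "d s $ 2 = - sin (w * s) * m$1 + cos (w * s) * m$2" for s
      using rotation_unique[of "\<lambda>s. d s $ 1" w "\<lambda>s. d s $ 2" s] D d0
      by (simp_all add: const w_def)
    then show "d = c" by (simp add: c_def fun_eq_iff vec_eq_iff forall_3 const)
  qed
  then show ?thesis by (simp add: c_def w_def)
qed

end

theory Submission
  imports Defs
begin

text \<open>
  In terms of the cross product, \<open>\<Pi>(m) v = m \<times> v\<close>, and the flow of a function
  \<open>F = (e \<bullet> m)\<^sup>2 / (2 I)\<close> with a unit vector \<open>e\<close> is a \<^emph>\<open>twist\<close>: the point \<open>m\<close> is rotated about the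
  axis \<open>e\<close>, and the angle is \<open>t / I\<close> times the height \<open>e \<bullet> m\<close>, which the rotation preserves. The three
  flows of the splitting are the twists about the coordinate axes, so everything follows from facts
  about one twist, stated for an arbitrary unit axis so that the three axes need no separate treatment.

  A twist \<open>\<phi>\<close> is a Poisson map. Write \<open>R\<close> for the rotation that it applies at \<open>m\<close>. The derivative of
  \<open>\<phi>\<close> at \<open>m\<close> is \<open>R\<close> plus a rank-one term \<open>h \<mapsto> k (e \<bullet> h) w\<close> with \<open>w = R m \<times> e\<close>, which comes from the
  variation of the angle. Hence the gradient of \<open>f \<circ> \<phi>\<close> at \<open>m\<close> is \<open>R\<^sup>T a + k (w \<bullet> a) e\<close>, where
  \<open>a\<close> is the gradient of \<open>f\<close> at \<open>R m\<close>. In the bracket of \<open>f \<circ> \<phi>\<close> and \<open>g \<circ> \<phi>\<close> the two rank-one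
  contributions are \<open>k (w \<bullet> a) (w \<bullet> b)\<close> with opposite signs and cancel, and what is left is the
  bracket of \<open>f\<close> and \<open>g\<close> at \<open>R m\<close>, because rotations respect the cross product
  (\<open>rotation_cross3\<close>). This is \<open>poisson_map_twist\<close>; Poisson maps compose (\<open>poisson_map_comp\<close>).

  For regularity, a twist is an expression in its angle factor and in its argument that is built
  from bilinear operations, sine and cosine. The class \<open>C\<^sup>k\<close> is closed under these, so
  \<open>times_cont_differentiable_twist\<close> gives both the smoothness in space and the differentiability in
  time of the composition, without a chain rule for \<open>C\<^sup>k\<close> maps.
\<close>

section \<open>Closure properties of continuously differentiable maps\<close>

text \<open>
  The definition speaks of the operator \<^const>\<open>frechet_derivative\<close>; this rule allows any family of
  derivatives to be used instead.
\<close>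
lemma times_cont_differentiable_SucI:
  assumes "\<And>x. (f has_derivative f' x) (at x)"
    and "\<And>v. times_cont_differentiable k (\<lambda>x. f' x v)"
  shows "times_cont_differentiable (Suc k) f"
proof -
  have "frechet_derivative f (at x) = f' x" for x
    using frechet_derivative_at[OF assms(1)] by simp
  then show ?thesis
    using assms by (auto simp: differentiable_def)
qed

lemma times_cont_differentiable_Suc_has_derivative:
  assumes "times_cont_differentiable (Suc k) f"
  shows "(f has_derivative frechet_derivative f (at x)) (at x)"
  using assms by (simp flip: frechet_derivative_works)

text \<open>
  The derivative of a product contains the factors themselves, so inductions on the order need
  that the order can be lowered.
\<close>
lemma times_cont_differentiable_SucD:
  "times_cont_differentiable (Suc k) f \<Longrightarrow> times_cont_differentiable k f"
proof (induction k arbitrary: f)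
  case 0
  then show ?case
    by (auto simp: continuous_on_eq_continuous_at differentiable_imp_continuous_within)
next
  case (Suc k)
  then show ?case by (subst times_cont_differentiable.simps) auto
qed

lemma times_cont_differentiable_const: "times_cont_differentiable k (\<lambda>x. c)"
proof (induction k arbitrary: c)
  case (Suc k)
  then show ?case
    by (intro times_cont_differentiable_SucI[where f' = "\<lambda>_ _. 0"]) auto
qed simp

lemma times_cont_differentiable_id: "times_cont_differentiable k (\<lambda>x. x)"
proof (cases k)
  case (Suc l)
  then show ?thesis
    by (auto intro!: times_cont_differentiable_SucI[where f' = "\<lambda>_ v. v"]
        times_cont_differentiable_const)
qed simp

lemma times_cont_differentiable_add:
  assumes "times_cont_differentiable k f" "times_cont_differentiable k g"
  shows "times_cont_differentiable k (\<lambda>x. f x + g x)"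
  using assms
proof (induction k arbitrary: f g)
  case (Suc k)
  note [derivative_intros] = Suc.prems[THEN times_cont_differentiable_Suc_has_derivative]
  show ?case
    by (rule times_cont_differentiable_SucI, (rule derivative_intros)+, rule Suc.IH)
       (use Suc.prems in auto)
qed (auto intro: continuous_on_add)

text \<open>
  One induction covers every product that occurs in a twist: of reals, scalar, inner and cross.
\<close>
lemma times_cont_differentiable_bilinear:
  assumes "bounded_bilinear B"
    and "times_cont_differentiable k f" "times_cont_differentiable k g"
  shows "times_cont_differentiable k (\<lambda>x. B (f x) (g x))"
  using assms(2,3)
proof (induction k arbitrary: f g)
  case 0
  then show ?case using bounded_bilinear.continuous_on[OF assms(1)] by auto
next
  case (Suc k)
  note D = Suc.prems[THEN times_cont_differentiable_Suc_has_derivative]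
  show ?case
    by (rule times_cont_differentiable_SucI, rule bounded_bilinear.FDERIV[OF assms(1) D],
        intro times_cont_differentiable_add Suc.IH)
       (use Suc.prems times_cont_differentiable_SucD in auto)
qed

text \<open>
  Each of the two functions is, up to sign, the derivative of the other, so the induction has to
  treat them together.
\<close>
lemma times_cont_differentiable_sin_cos:
  fixes f :: "'a::real_normed_vector \<Rightarrow> real"
  assumes "times_cont_differentiable k f"
  shows "times_cont_differentiable k (\<lambda>x. sin (f x)) \<and> times_cont_differentiable k (\<lambda>x. cos (f x))"
  using assms
proof (induction k arbitrary: f)
  case 0
  then show ?case by (auto intro: continuous_intros)
next
  case (Suc k)
  note D = times_cont_differentiable_Suc_has_derivative[OF Suc.prems]
  note sc = Suc.IH[OF times_cont_differentiable_SucD[OF Suc.prems]]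
  note mult = times_cont_differentiable_bilinear[OF bounded_bilinear_mult]
  have "times_cont_differentiable (Suc k) (\<lambda>x. sin (f x))"
    by (rule times_cont_differentiable_SucI[where f' = "\<lambda>x v. cos (f x) * frechet_derivative f (at x) v"])
       (use Suc.prems sc in \<open>auto intro!: mult derivative_eq_intros D\<close>)
  \<comment> \<open>The sign is kept as a factor, so that the product rule covers it as well.\<close>
  moreover have "times_cont_differentiable (Suc k) (\<lambda>x. cos (f x))"
  proof (rule times_cont_differentiable_SucI)
    show "((\<lambda>x. cos (f x)) has_derivative
        (\<lambda>v. - 1 * (sin (f x) * frechet_derivative f (at x) v))) (at x)" for x
      by (auto intro!: derivative_eq_intros D)
    show "times_cont_differentiable k (\<lambda>x. - 1 * (sin (f x) * frechet_derivative f (at x) v))" for v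
      using Suc.prems sc by (intro mult times_cont_differentiable_const) auto
  qed
  ultimately show ?case ..
qed

lemma times_cont_differentiable_diff:
  assumes "times_cont_differentiable k f" "times_cont_differentiable k g"
  shows "times_cont_differentiable k (\<lambda>x. f x - g x)"
  using times_cont_differentiable_add[OF assms(1)
      times_cont_differentiable_bilinear[OF bounded_bilinear_scaleR
        times_cont_differentiable_const[of k "- 1"] assms(2)]]
  by simp

section \<open>Rotations and twists\<close>

text \<open>
  Rodrigues' formula for the rotation about a unit vector \<open>e\<close>; the sign of the last term makes it
  clockwise for \<open>\<theta> > 0\<close>, as the flows of the rigid body are.
\<close>
definition rotation :: "real \<Rightarrow> real^3 \<Rightarrow> real^3 \<Rightarrow> real^3" where
  "rotation \<theta> e v = (e \<bullet> v) *\<^sub>R e + cos \<theta> *\<^sub>R (v - (e \<bullet> v) *\<^sub>R e) - sin \<theta> *\<^sub>R cross3 e v"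

text \<open>
  The flow at time \<open>t\<close> of \<open>(e \<bullet> m)\<^sup>2 / (2 I)\<close>, with \<open>k = t / I\<close>.
\<close>
definition twist :: "real \<Rightarrow> real^3 \<Rightarrow> real^3 \<Rightarrow> real^3" where
  "twist k e m = rotation (k * (e \<bullet> m)) e m"

lemma bounded_bilinear_cross3: "bounded_bilinear cross3"
  using bilinear_cross bilinear_conv_bounded_bilinear by blast

text \<open>
  Both the angle factor and the point may vary, so that the parameter can be either the initial
  point or the time.
\<close>
lemma times_cont_differentiable_twist:
  assumes "times_cont_differentiable n k" "times_cont_differentiable n f"
  shows "times_cont_differentiable n (\<lambda>x. twist (k x) e (f x))"
proof -
  note bil = bounded_bilinear_inner bounded_bilinear_scaleR bounded_bilinear_mult
    bounded_bilinear_cross3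
  show ?thesis
    unfolding twist_def rotation_def
    by (intro times_cont_differentiable_diff times_cont_differentiable_add
        bil[THEN times_cont_differentiable_bilinear]
        times_cont_differentiable_sin_cos[THEN conjunct1]
        times_cont_differentiable_sin_cos[THEN conjunct2]
        times_cont_differentiable_const assms)
qed

text \<open>
  Lagrange's expansion of the double cross product; it evaluates all products of \<open>e\<close>,
  \<open>e \<times> p\<close> and \<open>e \<times> q\<close> for \<open>p\<close>, \<open>q\<close> orthogonal to the axis \<open>e\<close>.
\<close>
lemma cross3_cross3: "cross3 x (cross3 y z) = (x \<bullet> z) *\<^sub>R y - (x \<bullet> y) *\<^sub>R z"
  by (simp add: cross3_simps forall_3)

lemma rotation_split:
  assumes "e \<bullet> e = 1" "e \<bullet> p = 0"
  shows "rotation \<theta> e (\<alpha> *\<^sub>R e + p) = \<alpha> *\<^sub>R e + cos \<theta> *\<^sub>R p - sin \<theta> *\<^sub>R cross3 e p"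
  using assms by (simp add: rotation_def inner_add_right cross_add_right cross_mult_right)

text \<open>
  The projection onto the axis is self-adjoint and the cross product with it is skew, which is why
  reversing the angle gives the transpose.
\<close>
lemma rotation_transpose: "rotation \<theta> e u \<bullet> v = u \<bullet> rotation (- \<theta>) e v"
  by (simp add: rotation_def cross3_simps)

lemma rotation_inverse:
  assumes "norm e = 1"
  shows "rotation \<theta> e (rotation (- \<theta>) e v) = v"
proof -
  have ee: "e \<bullet> e = 1"
    using assms by (simp add: norm_eq_1)
  define p where "p = v - (e \<bullet> v) *\<^sub>R e"
  have ep: "e \<bullet> p = 0"
    by (simp add: p_def inner_diff_right ee)
  have eep: "cross3 e (cross3 e p) = - p"
    by (simp add: cross3_cross3 ep ee)
  have v: "v = (e \<bullet> v) *\<^sub>R e + p"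
    by (simp add: p_def)
  define c s where "c = cos \<theta>" and "s = sin \<theta>"
  have cs: "c * c + s * s = 1"
    by (metis c_def s_def power2_eq_square sin_cos_squared_add2)
  have "rotation (- \<theta>) e v = (e \<bullet> v) *\<^sub>R e + (c *\<^sub>R p + s *\<^sub>R cross3 e p)"
    by (subst v, subst rotation_split) (simp_all add: ee ep c_def s_def)
  also have "rotation \<theta> e \<dots> = (e \<bullet> v) *\<^sub>R e + (c * c + s * s) *\<^sub>R p"
    by (subst rotation_split)
       (simp_all add: ee ep eep dot_cross_self cross_add_right cross_mult_right
        algebra_simps flip: c_def s_def)
  finally show ?thesis
    using v by (simp add: cs)
qed

text \<open>
  Both vectors are split into their parts \<open>\<alpha> e\<close>, \<open>\<beta> e\<close> along the axis and \<open>p\<close>, \<open>q\<close> orthogonal to it.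
  Then \<open>p \<times> q = \<mu> e\<close>, and on the right-hand side \<open>\<mu> e\<close> appears with the coefficient
  \<open>cos\<^sup>2 \<theta> + sin\<^sup>2 \<theta>\<close>, while the two mixed terms \<open>(p \<bullet> q) e\<close> cancel.
\<close>
lemma rotation_cross3:
  assumes "norm e = 1"
  shows "rotation \<theta> e (cross3 u v) = cross3 (rotation \<theta> e u) (rotation \<theta> e v)"
proof -
  have ee: "e \<bullet> e = 1"
    using assms by (simp add: norm_eq_1)
  define \<alpha> \<beta> where "\<alpha> = e \<bullet> u" and "\<beta> = e \<bullet> v"
  define p q where "p = u - \<alpha> *\<^sub>R e" and "q = v - \<beta> *\<^sub>R e"
  define \<mu> where "\<mu> = e \<bullet> cross3 p q"
  have ep: "e \<bullet> p = 0" and eq: "e \<bullet> q = 0"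
    by (simp_all add: p_def q_def \<alpha>_def \<beta>_def inner_diff_right ee)
  have u: "u = \<alpha> *\<^sub>R e + p" and v: "v = \<beta> *\<^sub>R e + q"
    by (simp_all add: p_def q_def)
  have eep: "cross3 e (cross3 e p) = - p" and eeq: "cross3 e (cross3 e q) = - q"
    by (simp_all add: cross3_cross3 ep eq ee)
  have pe: "cross3 p e = - cross3 e p"
    by (rule cross_skew)
  have "cross3 e (cross3 p q) = 0"
    by (simp add: cross3_cross3 ep eq)
  with cross3_cross3[of e e "cross3 p q"] have pq: "cross3 p q = \<mu> *\<^sub>R e"
    by (simp add: ee \<mu>_def)
  have peq: "cross3 p (cross3 e q) = (p \<bullet> q) *\<^sub>R e"
    using ep by (simp add: cross3_cross3 inner_commute)
  have epq: "cross3 (cross3 e p) q = - ((p \<bullet> q) *\<^sub>R e)"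
    using eq by (subst cross_skew) (simp add: cross3_cross3 inner_commute)
  have epeq: "cross3 (cross3 e p) (cross3 e q) = \<mu> *\<^sub>R e"
    by (simp add: cross3_cross3 dot_cross_self \<mu>_def) (simp add: cross3_simps)
  have epe: "cross3 (cross3 e p) e = p"
    using eep by (subst cross_skew) simp
  define c s where "c = cos \<theta>" and "s = sin \<theta>"
  have cs: "c * c + s * s = 1"
    by (metis c_def s_def power2_eq_square sin_cos_squared_add2)
  have Ru: "rotation \<theta> e u = \<alpha> *\<^sub>R e + (c *\<^sub>R p - s *\<^sub>R cross3 e p)"
    and Rv: "rotation \<theta> e v = \<beta> *\<^sub>R e + (c *\<^sub>R q - s *\<^sub>R cross3 e q)"
    unfolding u v by (simp_all add: rotation_split ee ep eq c_def s_def)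
  have uv: "cross3 u v = \<mu> *\<^sub>R e + (\<alpha> *\<^sub>R cross3 e q - \<beta> *\<^sub>R cross3 e p)"
    unfolding u v by (simp add: cross_add_left cross_add_right cross_mult_left cross_mult_right pq pe)
  have "cross3 (rotation \<theta> e u) (rotation \<theta> e v) = (c * c + s * s) *\<^sub>R \<mu> *\<^sub>R e
      + \<alpha> *\<^sub>R (c *\<^sub>R cross3 e q + s *\<^sub>R q) - \<beta> *\<^sub>R (c *\<^sub>R cross3 e p + s *\<^sub>R p)"
    unfolding Ru Rv
    by (simp add: cross_add_left cross_add_right cross_mult_left cross_mult_right
        Cross3.left_diff_distrib Cross3.right_diff_distrib pq pe peq epq epeq epe eeq
        algebra_simps)
  also have "\<dots> = rotation \<theta> e (cross3 u v)"
    unfolding uv cs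
    by (subst rotation_split)
       (simp_all add: ee dot_cross_self inner_diff_right Cross3.right_diff_distrib
        cross_mult_right eep eeq algebra_simps flip: c_def s_def)
  finally show ?thesis ..
qed

text \<open>
  The first term rotates the increment with the angle held fixed. The second one comes from the
  change of the angle: increasing \<open>\<theta>\<close> moves a rotated point \<open>x\<close> with velocity \<open>- e \<times> x\<close>.
\<close>
lemma twist_has_derivative:
  assumes "norm e = 1"
  shows "(twist k e has_derivative
    (\<lambda>h. rotation (k * (e \<bullet> m)) e h - (k * (e \<bullet> h)) *\<^sub>R cross3 e (twist k e m))) (at m)"
proof -
  note [derivative_intros] = bounded_bilinear.FDERIV[OF bounded_bilinear_cross3]
  have ee: "cross3 e (cross3 e m) = (e \<bullet> m) *\<^sub>R e - m"
    using assms by (simp add: cross3_cross3 norm_eq_1)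
  show ?thesis
    unfolding twist_def rotation_def
    by (auto intro!: derivative_eq_intros simp: cross_add_right cross_mult_right
        Cross3.right_diff_distrib ee algebra_simps)
qed

section \<open>Poisson maps\<close>

text \<open>
  The test functions range over all differentiable functions, of which the smooth ones are a special
  case: the bracket involves first derivatives only, and the ordinary chain rule shows that this
  larger class is preserved by \<open>f \<mapsto> f \<circ> \<phi>\<close>.
\<close>
definition poisson_map :: "(real^'n \<Rightarrow> real^'n^'n) \<Rightarrow> (real^'n \<Rightarrow> real^'n) \<Rightarrow> bool" where
  "poisson_map P \<phi> \<longleftrightarrow> (\<forall>x. \<phi> differentiable (at x)) \<and>
     (\<forall>f g. (\<forall>x. f differentiable (at x)) \<longrightarrow> (\<forall>x. g differentiable (at x)) \<longrightarrow>
        poisson_bracket P f g \<circ> \<phi> = poisson_bracket P (f \<circ> \<phi>) (g \<circ> \<phi>))"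

lemma poisson_map_comp:
  assumes "poisson_map P \<phi>" "poisson_map P \<psi>"
  shows "poisson_map P (\<phi> \<circ> \<psi>)"
proof -
  have diff: "\<phi> differentiable (at x)" "\<psi> differentiable (at x)" for x
    using assms by (simp_all add: poisson_map_def)
  have "poisson_bracket P f g \<circ> (\<phi> \<circ> \<psi>) = poisson_bracket P (f \<circ> (\<phi> \<circ> \<psi>)) (g \<circ> (\<phi> \<circ> \<psi>))"
    if f: "\<forall>x. f differentiable (at x)" and g: "\<forall>x. g differentiable (at x)" for f g
  proof -
    have f\<phi>: "\<forall>x. (f \<circ> \<phi>) differentiable (at x)" and g\<phi>: "\<forall>x. (g \<circ> \<phi>) differentiable (at x)"
      using f g diff by (simp_all add: differentiable_chain_at)
    have "poisson_bracket P f g \<circ> \<phi> \<circ> \<psi> = poisson_bracket P (f \<circ> \<phi>) (g \<circ> \<phi>) \<circ> \<psi>"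
      using assms(1) f g by (simp add: poisson_map_def)
    also have "\<dots> = poisson_bracket P (f \<circ> \<phi> \<circ> \<psi>) (g \<circ> \<phi> \<circ> \<psi>)"
      using assms(2) f\<phi> g\<phi> by (simp add: poisson_map_def)
    finally show ?thesis
      by (simp add: comp_assoc)
  qed
  with diff show ?thesis
    by (simp add: poisson_map_def differentiable_chain_at)
qed

text \<open>
  By Riesz representation: the gradient is the image of 1 under the adjoint of the derivative.
\<close>
lemma GDERIV_gradient:
  assumes "F differentiable (at x)"
  shows "GDERIV F x :> gradient F x"
proof -
  obtain F' where F': "(F has_derivative F') (at x)"
    using assms by (auto simp: differentiable_def)
  have "F' = (\<lambda>h. h \<bullet> adjoint F' 1)"
    using adjoint_works[OF has_derivative_linear[OF F'], of _ 1] by (auto simp: fun_eq_iff)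
  with F' have "GDERIV F x :> adjoint F' 1"
    by (simp add: gderiv_def)
  with gradient_eqI show ?thesis by metis
qed

text \<open>
  The hypothesis on \<open>a\<close> says that \<open>a\<close> is the transpose of \<open>D\<close> applied to the gradient of \<open>F\<close>; it is
  stated with inner products so that no adjoint of \<open>D\<close> has to be computed.
\<close>
lemma gradient_comp:
  assumes "(\<phi> has_derivative D) (at x)" "F differentiable (at (\<phi> x))"
    and "\<And>h. D h \<bullet> gradient F (\<phi> x) = h \<bullet> a"
  shows "gradient (F \<circ> \<phi>) x = a"
proof (rule gradient_eqI)
  have "(F \<circ> \<phi> has_derivative (\<lambda>h. h \<bullet> gradient F (\<phi> x)) \<circ> D) (at x)"
    by (intro diff_chain_at assms(1) GDERIV_gradient[OF assms(2), unfolded gderiv_def])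
  then show "GDERIV (F \<circ> \<phi>) x :> a"
    by (simp add: gderiv_def comp_def assms(3))
qed

lemma rigid_body_Pi_cross3: "rigid_body_Pi m *v v = cross3 m v"
  by (simp add: rigid_body_Pi_def vec_eq_iff forall_3 matrix_vector_mult_def sum_3 cross3_def)

text \<open>
  Here \<open>R\<close> is the rotation applied at \<open>m\<close>, \<open>R'\<close> its transpose, and \<open>a\<close>, \<open>b\<close> are the gradients of the test
  functions at the image point. The bracket of the pulled-back functions expands into the rotated
  bracket \<open>ab\<close> and two terms from the varying angle, which \<open>ae\<close> and \<open>eb\<close> evaluate to opposite values.
\<close>
lemma poisson_map_twist:
  assumes e: "norm e = 1"
  shows "poisson_map rigid_body_Pi (twist k e)"
  unfolding poisson_map_def
proof (intro conjI allI impI ext)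
  show "twist k e differentiable at x" for x
    using twist_has_derivative[OF e] by (auto simp: differentiable_def)
next
  fix f g :: "real^3 \<Rightarrow> real" and m
  assume f: "\<forall>x. f differentiable at x" and g: "\<forall>x. g differentiable at x"
  define R R' where "R = rotation (k * (e \<bullet> m)) e" and "R' = rotation (- (k * (e \<bullet> m))) e"
  define w where "w = cross3 (R m) e"
  have twist: "twist k e m = R m"
    by (simp add: twist_def R_def)
  have grad: "gradient (F \<circ> twist k e) m = R' a + (k * (w \<bullet> a)) *\<^sub>R e"
    if "\<forall>x. F differentiable at x" "a = gradient F (R m)" for F a
  proof (rule gradient_comp[OF twist_has_derivative[OF e]])
    show "(rotation (k * (e \<bullet> m)) e h - (k * (e \<bullet> h)) *\<^sub>R cross3 e (twist k e m)) \<bullet>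
        gradient F (twist k e m) = h \<bullet> (R' a + (k * (w \<bullet> a)) *\<^sub>R e)" for h
      unfolding twist that(2)[symmetric] R_def[symmetric] w_def cross_skew[of e]
      using rotation_transpose[of "k * (e \<bullet> m)" e h a]
      by (simp add: R'_def R_def algebra_simps inner_commute)
  qed (use that in simp)
  define a b where "a = gradient f (R m)" and "b = gradient g (R m)"
  have adj: "R' u \<bullet> v = u \<bullet> R v" for u v
    using rotation_transpose[of "- (k * (e \<bullet> m))" e] by (simp add: R_def R'_def)
  have R_cross: "R (cross3 u (R' v)) = cross3 (R u) v" for u v
    using rotation_cross3[OF e] rotation_inverse[OF e] by (simp add: R_def R'_def)
  have R'e: "R' e = e"
    using e by (simp add: R'_def rotation_def norm_eq_1)
  have ab: "R' a \<bullet> cross3 m (R' b) = a \<bullet> cross3 (R m) b"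
    by (simp add: adj R_cross)
  have ae: "R' a \<bullet> cross3 m e = w \<bullet> a"
    using R_cross[of m e] by (simp add: adj R'e w_def inner_commute)
  have eb: "e \<bullet> cross3 m (R' b) = - (w \<bullet> b)"
  proof -
    have "e \<bullet> cross3 m (R' b) = R' e \<bullet> cross3 m (R' b)" by (simp add: R'e)
    also have "\<dots> = e \<bullet> cross3 (R m) b" by (simp add: adj R_cross)
    also have "\<dots> = - (w \<bullet> b)" by (simp add: w_def cross3_simps)
    finally show ?thesis .
  qed
  have "poisson_bracket rigid_body_Pi (f \<circ> twist k e) (g \<circ> twist k e) m =
      (R' a + (k * (w \<bullet> a)) *\<^sub>R e) \<bullet> cross3 m (R' b + (k * (w \<bullet> b)) *\<^sub>R e)"
    by (simp add: poisson_bracket_def rigid_body_Pi_cross3 grad[OF f a_def] grad[OF g b_def])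
  also have "\<dots> = a \<bullet> cross3 (R m) b"
    by (simp add: cross_add_right cross_mult_right inner_add_left inner_add_right dot_cross_self
        ab ae eb)
  finally show "(poisson_bracket rigid_body_Pi f g \<circ> twist k e) m =
      poisson_bracket rigid_body_Pi (f \<circ> twist k e) (g \<circ> twist k e) m"
    by (simp add: poisson_bracket_def rigid_body_Pi_cross3 twist a_def b_def)
qed

section \<open>The Lie-Trotter integrator\<close>

lemma rigid_body_flow_twist:
  "flow (hamiltonian_vf rigid_body_Pi (H1 I)) t = twist (t / I) (axis 1 1)"
  "flow (hamiltonian_vf rigid_body_Pi (H2 I)) t = twist (t / I) (axis 2 1)"
  "flow (hamiltonian_vf rigid_body_Pi (H3 I)) t = twist (t / I) (axis 3 1)"
  unfolding fun_eq_iff flow_H1 flow_H2 flow_H3 twist_def rotation_def inner_axis' Let_def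
  by (simp_all add: vec_eq_iff forall_3 cross3_def axis_def algebra_simps)

theorem theorem4p1:
  fixes I1 I3 :: real
  assumes "I1 > I3" and "I3 > 0"
  shows "poisson_integrator rigid_body_Pi (lie_trotter I1 I3)"
proof -
  have lt: "lie_trotter I1 I3 t =
      twist (t / I1) (axis 1 1) \<circ> twist (t / I1) (axis 2 1) \<circ> twist (t / I3) (axis 3 1)" for t
    by (simp add: lie_trotter_def rigid_body_flow_twist)
  have poisson: "poisson_map rigid_body_Pi (lie_trotter I1 I3 t)" for t
    unfolding lt by (intro poisson_map_comp poisson_map_twist norm_axis_1)
  have smooth_m: "smooth (lie_trotter I1 I3 t)" for t
    unfolding lt smooth_def comp_def
    by (intro allI times_cont_differentiable_twist times_cont_differentiable_const
        times_cont_differentiable_id)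
  have div: "times_cont_differentiable 1 (\<lambda>s. s / I)" for I :: real
    unfolding divide_inverse
    by (intro times_cont_differentiable_bilinear[OF bounded_bilinear_mult]
        times_cont_differentiable_const times_cont_differentiable_id)
  \<comment> \<open>Here the point is fixed and the angle factors depend on the time.\<close>
  have "times_cont_differentiable 1 (\<lambda>s. lie_trotter I1 I3 s x)" for x
    unfolding lt comp_def
    by (intro times_cont_differentiable_twist times_cont_differentiable_const div)
  then have diff_t: "(\<lambda>s. lie_trotter I1 I3 s x) differentiable (at t)" for x t
    by simp
  have "f differentiable (at x)" if "smooth f" for f :: "real^3 \<Rightarrow> real" and x
    using that times_cont_differentiable.simps(2)[of 0 f] unfolding smooth_def by blast
  then show ?thesis
    using poisson smooth_m diff_t
    unfolding poisson_integrator_def numerical_integrator_def poisson_map_def by blast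
qed

end
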